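(* For every integer $n\ge 3$ there exist a convex body $C\subset E^n$ that is centrally symmetric and centered at the origin (i.e. $C=-C$), and a lattice $\Lambda\subset E^n$, such that $C+\Lambda$ is a lattice covering of $E^n$, but there is no parallelohedron $P\subseteq C$ for which $P+\Lambda$ is a tiling of $E^n$ (with this same lattice $\Lambda$).
   Context: $E^n$ denotes $n$-dimensional Euclidean space $\mathbb{R}^n$. A convex body is a compact convex set with nonempty interior. A lattice $\Lambda$ in $E^n$ is the set of all integer linear combinations of $n$ linearly independent vectors (a basis of $\Lambda$). For a set $K$, $K+\Lambda$ denotes the family of translates $\{K+\lambda:\lambda\in\Lambda\}$. It is a lattice covering of $E^n$ if $\bigcup_{\lambda\in\Lambda}(K+\lambda)=E^n$. It is a tiling of $E^n$ if it is a covering and distinct translates $K+\lambda$, $K+\lambda'$ ($\lambda\ne\lambda'$ in $\Lambda$) have disjoint interiors. An $n$-dimensional parallelohedron is an $n$-dimensional convex polytope $P$ for which there is some lattice $\Lambda'$ such that $P+\Lambda'$ is a tiling of $E^n$; it is not required to be centered at the origin. *)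

theory Defs
  imports "HOL-Analysis.Analysis"
begin

definition convex_body :: "'a::euclidean_space set \<Rightarrow> bool" where
  "convex_body K \<longleftrightarrow> compact K \<and> convex K \<and> interior K \<noteq> {}"

definition is_lattice :: "'a::euclidean_space set \<Rightarrow> bool" where
  "is_lattice \<Lambda> \<longleftrightarrow>
     (\<exists>B. independent B \<and> card B = DIM('a) \<and>
          \<Lambda> = {(\<Sum>b\<in>B. of_int (c b) *\<^sub>R b) | c :: 'a \<Rightarrow> int. True})"

definition translate :: "'a::euclidean_space set \<Rightarrow> 'a \<Rightarrow> 'a set" where
  "translate K v = (\<lambda>x. x + v) ` K"

text \<open>The next two predicates concern the family of translates of \<open>K\<close> by the vectors of
  \<open>\<Lambda>\<close>; that \<open>\<Lambda>\<close> is a lattice is always required separately.\<close>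

definition lattice_covering :: "'a::euclidean_space set \<Rightarrow> 'a set \<Rightarrow> bool" where
  "lattice_covering K \<Lambda> \<longleftrightarrow> (\<Union>v\<in>\<Lambda>. translate K v) = UNIV"

definition lattice_tiling :: "'a::euclidean_space set \<Rightarrow> 'a set \<Rightarrow> bool" where
  "lattice_tiling K \<Lambda> \<longleftrightarrow>
     lattice_covering K \<Lambda> \<and>
     (\<forall>v\<in>\<Lambda>. \<forall>w\<in>\<Lambda>. v \<noteq> w \<longrightarrow>
        interior (translate K v) \<inter> interior (translate K w) = {})"

definition parallelohedron :: "'a::euclidean_space set \<Rightarrow> bool" where
  "parallelohedron P \<longleftrightarrow>
     polytope P \<and> aff_dim P = int (DIM('a)) \<and>
     (\<exists>\<Lambda>'. is_lattice \<Lambda>' \<and> lattice_tiling P \<Lambda>')"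

end

theory Submission
  imports Defs
begin

text \<open>A point covered by \<open>K\<close> but by no other translate of \<open>K\<close> must lie in every tile \<open>P\<close> contained in
  \<open>K\<close>. So it suffices that the convex hull of the open set of simply covered points contains
  \<open>l / 2\<close> for some nonzero lattice vector \<open>l\<close>: by symmetry it also contains \<open>- l / 2\<close>, and then
  \<open>P\<close> and \<open>P + l\<close> overlap. In dimension three take the hexagon
  \<open>\<bar>2p - q\<bar>, \<bar>2q - p\<bar>, \<bar>p + q\<bar> \<le> 1\<close>, a tile for the integer lattice of the plane, and over it
  the body between the graphs of \<open>max p (q - p) (-q) - 1\<close> and \<open>1 + min p (q - p) (-q)\<close>.
  The vertical length is at least 1 everywhere, so the integer translates cover; and near three
  alternate vertices of the hexagon the simply covered points reach above height \<open>1 / 2\<close>, so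
  their hull contains half of the vertical unit vector. Higher dimensions follow by taking the
  product with a cube.\<close>

section \<open>Centrally symmetric bodies as intersections of strips\<close>

definition strip_body :: "'a::euclidean_space set \<Rightarrow> 'a set" where
  "strip_body S = {x. \<forall>v\<in>S. \<bar>v \<bullet> x\<bar> \<le> 1}"

lemma strip_body_eq: "strip_body S = (\<Inter>v\<in>S. {x. v \<bullet> x \<le> 1} \<inter> {x. v \<bullet> x \<ge> -1})"
  by (auto simp: strip_body_def abs_le_iff)

lemma convex_strip_body: "convex (strip_body S)"
  unfolding strip_body_eq
  by (intro convex_INT convex_Int convex_halfspace_le convex_halfspace_ge)

lemma closed_strip_body: "closed (strip_body S)"
  unfolding strip_body_eq
  by (intro closed_INT ballI closed_Int closed_halfspace_le closed_halfspace_ge)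

lemma uminus_mem_strip_body: "- x \<in> strip_body S \<longleftrightarrow> x \<in> strip_body S"
  by (simp add: strip_body_def)

lemma uminus_strip_body: "uminus ` strip_body S = strip_body S"
  proof (intro subset_antisym subsetI)
  fix x assume "x \<in> strip_body S"
  then have "- (- x) \<in> uminus ` strip_body S"
    by (intro imageI) (simp add: uminus_mem_strip_body)
  then show "x \<in> uminus ` strip_body S"
    by simp
qed (auto simp: uminus_mem_strip_body)

text \<open>Finitely many strict inequalities, all satisfied at the origin, cut out an open subset
  of the body.\<close>

lemma interior_strip_body:
  assumes "finite S"
  shows "0 \<in> interior (strip_body S)"
proof (rule interiorI)
  show "open (\<Inter>v\<in>S. {x. v \<bullet> x < 1} \<inter> {x. v \<bullet> x > -1})"
    by (intro open_INT assms ballI open_Int open_halfspace_lt open_halfspace_gt)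
  show "(\<Inter>v\<in>S. {x. v \<bullet> x < 1} \<inter> {x. v \<bullet> x > -1}) \<subseteq> strip_body S"
    unfolding strip_body_eq by (intro INF_mono') auto
qed simp

section \<open>The integer lattice\<close>

definition int_lattice :: "(real ^ 'n) set" where
  "int_lattice = {x. \<forall>i. x $ i \<in> \<int>}"

lemma is_lattice_int_lattice: "is_lattice (int_lattice :: (real ^ 'n) set)"
proof -
  have comp: "(\<Sum>b\<in>Basis. of_int (c b) *\<^sub>R b :: real ^ 'n) $ i = of_int (c (axis i 1))"
    for c :: "real ^ 'n \<Rightarrow> int" and i
  proof -
    have "(\<Sum>b\<in>Basis. of_int (c b) *\<^sub>R b :: real ^ 'n) $ i
      = (\<Sum>b\<in>Basis. of_int (c b) *\<^sub>R b) \<bullet> axis i 1"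
      by (simp add: inner_axis)
    also have "\<dots> = of_int (c (axis i 1))"
      by (rule inner_sum_left_Basis) (simp add: axis_in_Basis_iff)
    finally show ?thesis .
  qed
  have "int_lattice = {(\<Sum>b\<in>Basis. of_int (c b) *\<^sub>R b) | c :: real ^ 'n \<Rightarrow> int. True}"
  proof (intro subset_antisym subsetI)
    fix x :: "real ^ 'n" assume x: "x \<in> int_lattice"
    \<comment> \<open>The coordinates are integral, so the floor is exact and only changes the
      type.\<close>
    define c where "c = (\<lambda>b :: real ^ 'n. \<lfloor>x \<bullet> b\<rfloor>)"
    have "x = (\<Sum>b\<in>Basis. of_int (c b) *\<^sub>R b)"
      unfolding vec_eq_iff comp using x by (simp add: c_def inner_axis int_lattice_def)
    then show "x \<in> {(\<Sum>b\<in>Basis. of_int (c b) *\<^sub>R b) | c :: real ^ 'n \<Rightarrow> int. True}" by blast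
  qed (auto simp: int_lattice_def comp simp del: sum_component)
  then show ?thesis
    unfolding is_lattice_def by (intro exI[of _ Basis]) (simp add: independent_Basis)
qed

section \<open>Simply covered points and tiles\<close>

lemma lattice_covering_iff:
  "lattice_covering K \<Lambda> \<longleftrightarrow> (\<forall>x. \<exists>v\<in>\<Lambda>. x - v \<in> K)"
proof -
  have "x \<in> translate K v \<longleftrightarrow> x - v \<in> K" for x v
    unfolding translate_def by (force simp: image_iff algebra_simps)
  then show ?thesis
    unfolding lattice_covering_def by (simp add: set_eq_iff)
qed

lemma interior_translate: "interior (translate K v) = translate (interior K) v"
  using interior_translation[of v K] by (simp add: translate_def add.commute)

text \<open>The translate \<open>P + v\<close> that covers \<open>x\<close> lies in
  \<open>K + v\<close>, and unique covering leaves only \<open>v = 0\<close>.\<close>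

lemma uniquely_covered_subset_tile:
  assumes "lattice_covering P \<Lambda>" "P \<subseteq> K" "\<And>x v. x \<in> W \<Longrightarrow> v \<in> \<Lambda> \<Longrightarrow> x - v \<in> K \<Longrightarrow> v = 0"
  shows "W \<subseteq> P"
proof
  fix x assume "x \<in> W"
  obtain v where "v \<in> \<Lambda>" "x - v \<in> P"
    using assms(1) unfolding lattice_covering_iff by blast
  with assms(2) assms(3)[OF \<open>x \<in> W\<close>] show "x \<in> P" by force
qed

lemma no_tile_if_half_vector_in_hull:
  assumes sym: "K = uminus ` K" and "open W"
    and uniq: "\<And>x v. x \<in> W \<Longrightarrow> v \<in> \<Lambda> \<Longrightarrow> x - v \<in> K \<Longrightarrow> v = 0"
    and neg: "\<And>v. v \<in> \<Lambda> \<Longrightarrow> - v \<in> \<Lambda>"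
    and l: "0 \<in> \<Lambda>" "l \<in> \<Lambda>" "l \<noteq> 0" "(1/2) *\<^sub>R l \<in> convex hull W"
    and P: "convex P" "P \<subseteq> K" "lattice_tiling P \<Lambda>"
  shows False
proof -
  have cov: "lattice_covering P \<Lambda>"
    using P(3) by (simp add: lattice_tiling_def)
  have "W \<subseteq> P"
    by (rule uniquely_covered_subset_tile[OF cov P(2) uniq])
  \<comment> \<open>Openness of \<open>W\<close> lifts the inclusion to the interior of
    \<open>P\<close>, which is convex and so also contains the hull.\<close>
  then have "W \<subseteq> interior P"
    by (simp add: \<open>open W\<close> interior_maximal)
  \<comment> \<open>Both \<open>K\<close> and \<open>\<Lambda>\<close> are invariant under negation,
    so \<open>x\<close> in \<open>K + v\<close> means \<open>- x\<close> in \<open>K - v\<close>,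
    and uniqueness at \<open>- x\<close> applies.\<close>
  moreover have "uminus ` W \<subseteq> P"
  proof (rule uniquely_covered_subset_tile[OF cov P(2)])
    fix x v assume "x \<in> uminus ` W" "v \<in> \<Lambda>" "x - v \<in> K"
    then have "- x \<in> W" "- (x - v) \<in> K"
      using sym by (auto simp del: minus_diff_eq)
    then show "v = 0"
      using uniq[of "- x" "- v"] neg[OF \<open>v \<in> \<Lambda>\<close>] by simp
  qed
  then have "uminus ` W \<subseteq> interior P"
    by (simp add: \<open>open W\<close> interior_maximal open_negations)
  ultimately have "convex hull W \<subseteq> interior P" "convex hull (uminus ` W) \<subseteq> interior P"
    by (simp_all add: hull_minimal convex_interior P(1))
  moreover have "- ((1/2) *\<^sub>R l) \<in> convex hull (uminus ` W)"
    using l(4) convex_hull_linear_image[OF linear_uminus, of W] by blast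
  ultimately have half: "(1/2) *\<^sub>R l \<in> interior P" "- ((1/2) *\<^sub>R l) \<in> interior P"
    using l(4) by auto
  \<comment> \<open>Half of \<open>l\<close> is also the shift by \<open>l\<close> of an interior
    point of \<open>P\<close>, so the interiors of \<open>P\<close> and \<open>P + l\<close>
    meet.\<close>
  have "(1/2) *\<^sub>R l = - ((1/2) *\<^sub>R l) + l"
    by (simp add: algebra_simps flip: scaleR_add_left)
  then have "(1/2) *\<^sub>R l \<in> translate (interior P) l"
    unfolding translate_def using half(2) by blast
  moreover have "(1/2) *\<^sub>R l \<in> translate (interior P) 0"
    using half(1) by (simp add: translate_def)
  ultimately show False
    using P(3) l unfolding lattice_tiling_def interior_translate by (metis disjoint_iff)
qed

lemma hexagon_covering:
  fixes p q :: real
  obtains m n :: int where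
    "\<bar>2 * (p - m) - (q - n)\<bar> \<le> 1" "\<bar>2 * (q - n) - (p - m)\<bar> \<le> 1" "\<bar>(p - m) + (q - n)\<bar> \<le> 1"
proof -
  define x y where "x = p - \<lfloor>p\<rfloor>" and "y = q - \<lfloor>q\<rfloor>"
  have xy: "0 \<le> x" "x < 1" "0 \<le> y" "y < 1"
    unfolding x_def y_def by linarith+
  note pick = that
  have shift: thesis
    if "\<bar>2 * (x - i) - (y - j)\<bar> \<le> 1" "\<bar>2 * (y - j) - (x - i)\<bar> \<le> 1" "\<bar>(x - i) + (y - j)\<bar> \<le> 1"
    for i j :: int
    using that by (intro pick[of "\<lfloor>p\<rfloor> + i" "\<lfloor>q\<rfloor> + j"]) (simp_all add: x_def y_def algebra_simps)
  \<comment> \<open>The cases put \<open>(x, y)\<close> into the hexagon centred at the corner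
    \<open>(0, 0)\<close>, \<open>(1, 1)\<close>, \<open>(1, 0)\<close> or \<open>(0, 1)\<close> of
    the unit square, in this order.\<close>
  consider "x + y \<le> 1" "2 * x - y \<le> 1" "2 * y - x \<le> 1"
    | "x + y \<ge> 1" "x \<le> 2 * y" "y \<le> 2 * x"
    | "2 * x - y > 1" "2 * y \<le> x" | "2 * y - x > 1" "2 * x \<le> y"
    by linarith
  then show thesis
  proof cases
    case 1 with xy show ?thesis by (intro shift[of 0 0]) (auto simp: abs_le_iff)
  next
    case 2 with xy show ?thesis by (intro shift[of 1 1]) (auto simp: abs_le_iff)
  next
    case 3 with xy show ?thesis by (intro shift[of 1 0]) (auto simp: abs_le_iff)
  next
    case 4 with xy show ?thesis by (intro shift[of 0 1]) (auto simp: abs_le_iff)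
  qed
qed

text \<open>Up to sign, the differences of \<open>p\<close>, \<open>q - p\<close> and
  \<open>- q\<close> are the three forms bounded in the hypotheses. Hence their maximum
  \<open>m\<close> exceeds their minimum by at most 1, and the vertical section contains
  \<open>[m - 1, m]\<close>.\<close>

lemma height_covering:
  fixes p q z :: real
  assumes "\<bar>2 * p - q\<bar> \<le> 1" "\<bar>2 * q - p\<bar> \<le> 1" "\<bar>p + q\<bar> \<le> 1"
  obtains k :: int where "\<bar>(z - k) - p\<bar> \<le> 1" "\<bar>(z - k) + p - q\<bar> \<le> 1" "\<bar>(z - k) + q\<bar> \<le> 1"
proof -
  define m where "m = max p (max (q - p) (- q))"
  \<comment> \<open>chosen so that \<open>z - k\<close> lies in the unit interval starting at \<open>m - 1\<close>\<close>
  define k where "k = \<lfloor>z - m + 1\<rfloor>"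
  have "m - 1 \<le> z - k" "z - k \<le> m"
    unfolding k_def by linarith+
  moreover have "p \<le> m" "q - p \<le> m" "- q \<le> m"
    by (simp_all add: m_def)
  moreover have "m \<le> p + 1" "m \<le> q - p + 1" "m \<le> - q + 1"
    using assms unfolding m_def abs_le_iff max.bounded_iff by (intro conjI; linarith)+
  ultimately show thesis
    by (intro that[of k]; unfold abs_le_iff; intro conjI; argo)
qed

section \<open>The body in arbitrary dimension\<close>

context
  fixes a b c :: "'n::finite"
  assumes distinct: "a \<noteq> b" "a \<noteq> c" "b \<noteq> c"
begin

text \<open>Coordinates \<open>a\<close>, \<open>b\<close> carry the hexagon and \<open>c\<close>
  the height: the first row of normals bounds the hexagon, the second gives the lower and upper
  graphs. The factor 2 makes the remaining factor a cube of side 1.\<close>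

definition witness_normals :: "(real ^ 'n) set" where
  "witness_normals =
     {2 *\<^sub>R axis a 1 - axis b 1, 2 *\<^sub>R axis b 1 - axis a 1, axis a 1 + axis b 1,
      axis c 1 - axis a 1, axis c 1 + axis a 1 - axis b 1, axis c 1 + axis b 1}
     \<union> (\<lambda>i. 2 *\<^sub>R axis i 1) ` (- {a, b, c})"

abbreviation witness_body :: "(real ^ 'n) set" where
  "witness_body \<equiv> strip_body witness_normals"

lemma witness_body_iff:
  "x \<in> witness_body \<longleftrightarrow>
     \<bar>2 * x$a - x$b\<bar> \<le> 1 \<and> \<bar>2 * x$b - x$a\<bar> \<le> 1 \<and> \<bar>x$a + x$b\<bar> \<le> 1 \<and>
     \<bar>x$c - x$a\<bar> \<le> 1 \<and> \<bar>x$c + x$a - x$b\<bar> \<le> 1 \<and> \<bar>x$c + x$b\<bar> \<le> 1 \<and>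
     (\<forall>i. i \<notin> {a, b, c} \<longrightarrow> \<bar>2 * x$i\<bar> \<le> 1)"
  by (simp add: strip_body_def witness_normals_def inner_diff_left inner_add_left inner_axis' ball_Un)
    blast

lemma convex_body_witness_body: "convex_body witness_body"
  unfolding convex_body_def
proof (intro conjI)
  \<comment> \<open>Adding \<open>x$a + x$b\<close> to each of the other two hexagon forms gives
    \<open>3 * x$a\<close> and \<open>3 * x$b\<close>, which bounds both. The strip of
    \<open>x$c + x$b\<close> then bounds \<open>x$c\<close>.\<close>
  have "\<bar>x $ i\<bar> \<le> 2" if "x \<in> witness_body" for x i
  proof -
    have h: "\<bar>2 * x$a - x$b\<bar> \<le> 1" "\<bar>x$a + x$b\<bar> \<le> 1" "\<bar>x$c + x$b\<bar> \<le> 1"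
      "i \<notin> {a, b, c} \<Longrightarrow> \<bar>2 * x$i\<bar> \<le> 1"
      using that by (auto simp: witness_body_iff)
    then have "\<bar>x$a\<bar> \<le> 2" "\<bar>x$b\<bar> \<le> 1" using that by (auto simp: witness_body_iff abs_le_iff)
    then have "\<bar>x$c\<bar> \<le> 2" using h by (auto simp: abs_le_iff)
    with h(4) \<open>\<bar>x$a\<bar> \<le> 2\<close> \<open>\<bar>x$b\<bar> \<le> 1\<close> show ?thesis by (cases "i \<in> {a, b, c}") auto
  qed
  then have "witness_body \<subseteq> cbox (\<chi> i. - 2) (\<chi> i. 2)"
    by (auto simp: mem_box_cart abs_le_iff) (smt (verit))
  then have "bounded witness_body"
    by (rule bounded_subset[OF bounded_cbox])
  then show "compact witness_body"
    by (simp add: compact_eq_bounded_closed closed_strip_body)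
  have "finite witness_normals"
    by (simp add: witness_normals_def)
  from interior_strip_body[OF this] show "interior witness_body \<noteq> {}" by blast
qed (rule convex_strip_body)

lemma covering_witness_body: "lattice_covering witness_body int_lattice"
  unfolding lattice_covering_iff
proof
  fix x :: "real ^ 'n"
  obtain m n :: int where mn: "\<bar>2 * (x$a - m) - (x$b - n)\<bar> \<le> 1"
    "\<bar>2 * (x$b - n) - (x$a - m)\<bar> \<le> 1" "\<bar>(x$a - m) + (x$b - n)\<bar> \<le> 1"
    by (rule hexagon_covering)
  \<comment> \<open>The height is reduced after the plane, because the section to hit is the one
    over the reduced point.\<close>
  from height_covering[OF mn, of "x$c"] obtain k :: int where k: "\<bar>(x$c - k) - (x$a - m)\<bar> \<le> 1"
    "\<bar>(x$c - k) + (x$a - m) - (x$b - n)\<bar> \<le> 1" "\<bar>(x$c - k) + (x$b - n)\<bar> \<le> 1"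
    by blast
  define v :: "real ^ 'n" where
    "v = (\<chi> i. if i = a then m else if i = b then n else if i = c then k else round (x$i))"
  have v: "v$a = m" "v$b = n" "v$c = k" "i \<notin> {a, b, c} \<Longrightarrow> v$i = round (x$i)" for i
    using distinct by (auto simp: v_def)
  have "\<bar>2 * (x$i - round (x$i))\<bar> \<le> 1" for i
    using of_int_round_abs_le[of "x$i"] by argo
  then have "x - v \<in> witness_body"
    using mn k by (simp add: witness_body_iff v)
  moreover have "v \<in> int_lattice"
    by (simp add: int_lattice_def v_def)
  ultimately show "\<exists>v\<in>int_lattice. x - v \<in> witness_body" ..
qed

text \<open>The tips lie at \<open>9/10\<close> of three alternate vertices of the hexagon, and at height \<open>1/2\<close>, so that
  their centroid is half the vertical unit vector.\<close>

definition tip :: "real \<Rightarrow> real \<Rightarrow> real ^ 'n" where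
  "tip p q = (\<chi> i. if i = a then p else if i = b then q else if i = c then 1/2 else 0)"

lemma tip_nth [simp]:
  "tip p q $ a = p" "tip p q $ b = q" "tip p q $ c = 1/2" "i \<notin> {a, b, c} \<Longrightarrow> tip p q $ i = 0"
  using distinct by (auto simp: tip_def)

section \<open>Simply covered points near the tips\<close>

definition near_tips :: "(real ^ 'n) set" where
  "near_tips = (\<Union>(p, q) \<in> {(3/5, 3/10), (-3/10, 3/10), (-3/10, -3/5)}.
     box (tip p q - (\<chi> i. 1/100)) (tip p q + (\<chi> i. 1/100)))"

lemma near_tips_uniquely_covered:
  assumes "x \<in> near_tips" "v \<in> int_lattice" "x - v \<in> witness_body"
  shows "v = 0"
proof -
  obtain p q where pq: "(p, q) \<in> {(3/5, 3/10), (-3/10, 3/10), (-3/10, -3/5)}"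
    and x: "x \<in> box (tip p q - (\<chi> i. 1/100)) (tip p q + (\<chi> i. 1/100))"
    using assms(1) unfolding near_tips_def by blast
  from x have box: "tip p q $ i - 1/100 < x$i" "x$i < tip p q $ i + 1/100" for i
    by (simp_all add: mem_box_cart)
  have "\<exists>k::int. v$i = k" for i
    using assms(2) by (auto simp: int_lattice_def elim: Ints_cases)
  then obtain k where k: "\<And>i. v$i = real_of_int (k i)"
    by metis
  have hex: "\<bar>2 * (x$a - k a) - (x$b - k b)\<bar> \<le> 1" "\<bar>2 * (x$b - k b) - (x$a - k a)\<bar> \<le> 1"
      "\<bar>(x$a - k a) + (x$b - k b)\<bar> \<le> 1"
    and height: "\<bar>(x$c - k c) - (x$a - k a)\<bar> \<le> 1" "\<bar>(x$c - k c) + (x$a - k a) - (x$b - k b)\<bar> \<le> 1"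
      "\<bar>(x$c - k c) + (x$b - k b)\<bar> \<le> 1"
    and cube: "\<And>i. i \<notin> {a, b, c} \<Longrightarrow> \<bar>2 * (x$i - k i)\<bar> \<le> 1"
    using assms(3) unfolding witness_body_iff vector_minus_component k by blast+
  have near: "p - 1/100 < x$a" "x$a < p + 1/100" "q - 1/100 < x$b" "x$b < q + 1/100"
    "1/2 - 1/100 < x$c" "x$c < 1/2 + 1/100"
    using box[of a] box[of b] box[of c] by auto
  have pq_cases: "p = 3/5 \<and> q = 3/10 \<or> p = -3/10 \<and> q = 3/10 \<or> p = -3/10 \<and> q = -3/5"
    using pq by auto
  \<comment> \<open>At a tip these forms are at most 9/10 in absolute value, and moving within a box
    changes them by less than 3/100.\<close>
  have "\<bar>2 * x$a - x$b\<bar> < 1" "\<bar>2 * x$b - x$a\<bar> < 1" "\<bar>x$a + x$b\<bar> < 1"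
    using near pq_cases unfolding abs_less_iff by (elim disjE conjE; simp)+
  with hex have "\<bar>real_of_int (2 * k a - k b)\<bar> < 2" "\<bar>real_of_int (2 * k b - k a)\<bar> < 2"
    "\<bar>real_of_int (k a + k b)\<bar> < 2"
    unfolding abs_less_iff abs_le_iff by simp_all
  then have "\<bar>2 * k a - k b\<bar> < 2" "\<bar>2 * k b - k a\<bar> < 2" "\<bar>k a + k b\<bar> < 2"
    by linarith+
  \<comment> \<open>By integrality the three forms are at most 1 in absolute value, while
    \<open>3 * k a\<close> and \<open>3 * k b\<close> are sums of two of them.\<close>
  then have ab: "k a = 0" "k b = 0"
    unfolding abs_less_iff by presburger+
  \<comment> \<open>Over every tip the vertical section is \<open>[-2/5, 7/10]\<close>. Nonzero
    integer shifts of the height \<open>1/2\<close> miss it by at least \<open>1/10\<close>, more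
    than the boxes can make up.\<close>
  have "\<bar>real_of_int (k c)\<bar> < 1"
    using height near pq_cases unfolding ab abs_less_iff abs_le_iff by (elim disjE conjE; simp)
  then have "k c = 0"
    by linarith
  moreover have "k i = 0" if "i \<notin> {a, b, c}" for i
  proof -
    have "- 1/100 < x$i" "x$i < 1/100"
      using box[of i] that by auto
    with cube[OF that] have "\<bar>real_of_int (k i)\<bar> < 1"
      by argo
    then show ?thesis by linarith
  qed
  ultimately have "k i = 0" for i
    using ab by (cases "i \<in> {a, b, c}") auto
  then show ?thesis
    by (simp add: vec_eq_iff k)
qed

lemma half_axis_in_hull: "(1/2) *\<^sub>R axis c 1 \<in> convex hull near_tips"
proof -
  have tips: "tip (3/5) (3/10) \<in> near_tips" "tip (-3/10) (3/10) \<in> near_tips"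
    "tip (-3/10) (-3/5) \<in> near_tips"
    by (auto simp: near_tips_def mem_box_cart)
  have "(1/2) *\<^sub>R axis c 1 =
      (1/3) *\<^sub>R tip (3/5) (3/10) + (1/3) *\<^sub>R tip (-3/10) (3/10) + (1/3) *\<^sub>R tip (-3/10) (-3/5)"
    using distinct by (auto simp: vec_eq_iff tip_def axis_def)
  also have "\<dots> \<in> convex hull {tip (3/5) (3/10), tip (-3/10) (3/10), tip (-3/10) (-3/5)}"
    unfolding convex_hull_3 by (rule CollectI) (intro exI[of _ "1/3"], simp)
  also have "\<dots> \<subseteq> convex hull near_tips"
    using tips by (intro hull_mono) auto
  finally show ?thesis .
qed

lemma no_tile_in_witness_body:
  assumes "convex P" "P \<subseteq> witness_body" "lattice_tiling P int_lattice"
  shows False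
proof (rule no_tile_if_half_vector_in_hull[where W = near_tips and l = "axis c 1"])
  show "open near_tips"
    by (auto simp: near_tips_def intro!: open_Un)
  show "axis c 1 \<in> (int_lattice :: (real ^ 'n) set)"
    by (simp add: int_lattice_def axis_def)
  show "(1/2) *\<^sub>R axis c 1 \<in> convex hull near_tips"
    by (rule half_axis_in_hull)
  show "v = 0" if "x \<in> near_tips" "v \<in> int_lattice" "x - v \<in> witness_body" for x v
    using that by (rule near_tips_uniquely_covered)
qed (use assms in \<open>simp_all add: uminus_strip_body int_lattice_def\<close>)

end

theorem theorem1:
  assumes "CARD('n::finite) \<ge> 3"
  shows "\<exists>(C :: (real ^ 'n) set) \<Lambda>.
           convex_body C \<and> C = uminus ` C \<and>
           is_lattice \<Lambda> \<and> lattice_covering C \<Lambda> \<and>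
           \<not> (\<exists>P. parallelohedron P \<and> P \<subseteq> C \<and> lattice_tiling P \<Lambda>)"
proof -
  \<comment> \<open>Any three distinct indices can serve as the two plane coordinates and the
    height.\<close>
  obtain S :: "'n set" where "card S = 3"
    using assms by (meson obtain_subset_with_card_n)
  then obtain a b c :: 'n where abc: "a \<noteq> b" "a \<noteq> c" "b \<noteq> c"
    by (auto simp: card_3_iff)
  show ?thesis
  proof (rule exI[of _ "strip_body (witness_normals a b c)"], rule exI[of _ int_lattice],
      intro conjI)
    show "\<not> (\<exists>P. parallelohedron P \<and> P \<subseteq> strip_body (witness_normals a b c) \<and>
        lattice_tiling P int_lattice)"
      using no_tile_in_witness_body[OF abc]
      by (auto simp: parallelohedron_def dest: polytope_imp_convex)
  qed (simp_all add: abc convex_body_witness_body uminus_strip_body is_lattice_int_lattice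
      covering_witness_body)
qed

end
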